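(* There exist infinitely many nonnegative integers $n$ such that $s_2(n)=s_3(n)$. More precisely, for every real $\delta>0$ there is a constant $c=c(\delta)>0$ such that for all integers $N\ge 1$ $$\#\bigl\{0\le n<N: s_2(n)=s_3(n)\bigr\}\ \ge\ c\,N^{\frac{\log 3}{\log 4}-\delta}.$$
   Context: For an integer $q\ge 2$ and a nonnegative integer $n$, $s_q(n)$ denotes the sum of the digits of $n$ in its base-$q$ expansion. $\log$ is the natural logarithm. *)

theory Defs
  imports Complex_Main
begin

text \<open>Sum of the base-\<open>q\<close> digits of \<open>n\<close>, peeling off the least significant digit.
  The value \<open>0\<close> for \<open>q < 2\<close> is a dummy that makes the function total.\<close>

fun digit_sum :: "nat \<Rightarrow> nat \<Rightarrow> nat" where
  "digit_sum q n = (if q < 2 \<or> n = 0 then 0 else n mod q + digit_sum q (n div q))"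

declare digit_sum.simps [simp del]

text \<open>Below, \<open>ds\<close> is any base-\<open>q\<close> expansion, least significant digit first,
  possibly with leading zeros.\<close>

lemma digit_sum_horner_sum:
  assumes "q \<ge> 2" and "\<forall>d\<in>set ds. d < q"
  shows "digit_sum q (horner_sum (\<lambda>d. d) q ds) = sum_list ds"
  using assms(2)
proof (induction ds)
  case Nil
  then show ?case by (simp add: digit_sum.simps)
next
  case (Cons d ds)
  let ?m = "horner_sum (\<lambda>d. d) q ds"
  have d: "d < q" and IH: "digit_sum q ?m = sum_list ds"
    using Cons by auto
  show ?case
  proof (cases "d + q * ?m = 0")
    case True
    then have "d = 0" "?m = 0" using assms(1) by auto
    then show ?thesis using IH by (simp add: digit_sum.simps)
  next
    case False
    have "(d + q * ?m) mod q = d" "(d + q * ?m) div q = ?m"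
      using d by auto
    then show ?thesis
      using False assms(1) IH by (subst digit_sum.simps) auto
  qed
qed

end

theory Submission
  imports Defs "HOL-Number_Theory.Cong"
begin

text \<open>
  Write \<open>n = 2 ^ a * 3 ^ b * t + r\<close> with \<open>r < 2 ^ a \<le> 3 ^ b\<close>. Then the difference of the two digit sums
  of \<open>n\<close> is \<open>digit_sum 2 (3 ^ b * t) - digit_sum 3 (2 ^ a * t)\<close> plus the difference for \<open>r\<close>. For
  \<open>t < 2 ^ \<tau>\<close> with \<open>a\<close> much smaller than \<open>\<tau>\<close>, both digit sums are concentrated by a second moment
  estimate, with deviations of order \<open>sqrt \<tau>\<close>. The factor \<open>3 ^ b\<close> forces \<open>b\<close> ternary zeros, and the
  means agree when \<open>2 ^ \<tau>\<close> is about \<open>N powr (ln 3 / ln 4)\<close>, where \<open>N\<close> bounds \<open>n\<close>. For most \<open>t\<close> the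
  remaining discrepancy is cancelled by a suitable \<open>r < 2 ^ a\<close>, provided that the numbers below
  \<open>2 ^ a\<close> realise every difference up to a constant multiple of \<open>a\<close>. That in turn is obtained by
  bootstrapping the same argument (shifting the means by the choice of \<open>b\<close>), which multiplies \<open>a\<close> by
  \<open>9\<close> in each step; the starting point is a finite computation.
\<close>

subsection \<open>Digit sums\<close>

lemma digit_sum_eq: "q \<ge> 2 \<Longrightarrow> digit_sum q n = n mod q + digit_sum q (n div q)"
  by (cases "n = 0") (simp_all add: digit_sum.simps)

lemma digit_sum_0 [simp]: "digit_sum q 0 = 0"
  by (simp add: digit_sum.simps)

lemma digit_sum_less: "q \<ge> 2 \<Longrightarrow> n < q \<Longrightarrow> digit_sum q n = n"
  by (subst digit_sum_eq) auto

lemma digit_sum_div_mod_power: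
  assumes "q \<ge> 2"
  shows "digit_sum q n = digit_sum q (n div q ^ k) + digit_sum q (n mod q ^ k)"
proof (induction k arbitrary: n)
  case 0
  then show ?case by simp
next
  case (Suc k)
  have "digit_sum q (n mod q ^ Suc k) = n mod q + digit_sum q ((n div q) mod q ^ k)"
    using assms
    by (subst digit_sum_eq) (simp_all add: mod_mult2_eq)
  moreover have "digit_sum q n = n mod q + digit_sum q (n div q)"
    by (rule digit_sum_eq[OF assms])
  ultimately show ?case
    using Suc.IH[of "n div q"] by (simp add: div_mult2_eq)
qed

lemma digit_sum_power_mult_add:
  assumes "q \<ge> 2" "r < q ^ k"
  shows "digit_sum q (q ^ k * n + r) = digit_sum q n + digit_sum q r"
  using digit_sum_div_mod_power[OF assms(1), of "q ^ k * n + r" k] assms by simp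

text \<open>Complementing every digit turns \<open>l\<close> into \<open>q ^ k - 1 - l\<close>.\<close>

lemma digit_sum_complement:
  assumes "q \<ge> 2" "l < q ^ k"
  shows "digit_sum q (q ^ k - 1 - l) + digit_sum q l = (q - 1) * k"
  using assms(2)
proof (induction k arbitrary: l)
  case 0
  then show ?case by simp
next
  case (Suc k)
  define m j where "m = l div q" and "j = l mod q"
  have l: "l = q * m + j" and j: "j < q"
    using assms by (simp_all add: m_def j_def)
  have m: "m < q ^ k"
    using Suc.prems assms by (simp add: m_def less_mult_imp_div_less mult.commute)
  have "q ^ Suc k - 1 - l = q ^ 1 * (q ^ k - 1 - m) + (q - 1 - j)"
  proof -
    obtain c where "q ^ k = m + 1 + c"
      using m by (metis Suc_eq_plus1 less_iff_Suc_add add_Suc_right add_Suc add.commute)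
    moreover obtain d where "q = j + 1 + d"
      using j by (metis Suc_eq_plus1 less_iff_Suc_add add_Suc_right add_Suc add.commute)
    ultimately show ?thesis
      unfolding l by (simp add: algebra_simps)
  qed
  then have "digit_sum q (q ^ Suc k - 1 - l) = digit_sum q (q ^ k - 1 - m) + (q - 1 - j)"
    using digit_sum_power_mult_add[of q "q - 1 - j" 1] assms(1) by (simp add: digit_sum_less)
  moreover have "digit_sum q l = digit_sum q m + j"
    using digit_sum_power_mult_add[of q j 1 m] assms j by (simp add: l digit_sum_less)
  ultimately show ?case
    using Suc.IH[OF m] j by simp
qed

text \<open>The lower \<open>k\<close> digits of the product complement those of
  \<open>x - 1\<close>, which stand above them; so the total does not depend on
  \<open>x\<close>.\<close>

lemma digit_sum_mult_power_minus_1: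
  assumes "q \<ge> 2" "0 < x" "x \<le> q ^ k"
  shows "digit_sum q (x * (q ^ k - 1)) = (q - 1) * k"
proof -
  have "x * (q ^ k - 1) = q ^ k * (x - 1) + (q ^ k - 1 - (x - 1))"
  proof -
    obtain y where "x = Suc y" using assms(2) gr0_implies_Suc by blast
    moreover obtain c where "q ^ k = x + c"
      using assms(3) le_iff_add by blast
    ultimately show ?thesis by (simp add: algebra_simps)
  qed
  moreover have "q ^ k - 1 - (x - 1) < q ^ k"
    using assms by auto
  moreover have x: "x - 1 < q ^ k"
    using assms by linarith
  ultimately have "digit_sum q (x * (q ^ k - 1))
      = digit_sum q (x - 1) + digit_sum q (q ^ k - 1 - (x - 1))"
    by (simp only: digit_sum_power_mult_add[OF assms(1)])
  then show ?thesis
    using digit_sum_complement[OF assms(1) x] by linarith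
qed

text \<open>Reads binary digit sums off the \<open>Num\<close> constructors without division, which
  keeps numbers of several hundred bits cheap.\<close>

lemma digit_sum_2_numeral:
  "digit_sum 2 (numeral (Num.Bit0 n)) = digit_sum 2 (numeral n)"
  "digit_sum 2 (numeral (Num.Bit1 n)) = digit_sum 2 (numeral n) + 1"
  "digit_sum 2 (Suc 0) = Suc 0"
  by (subst digit_sum_eq; simp)+

subsection \<open>Differences realised by small numbers\<close>

definition digit_diff :: "nat \<Rightarrow> int" where
  "digit_diff n = int (digit_sum 2 n) - int (digit_sum 3 n)"

text \<open>The low-order zeros, \<open>a\<close> in base 2 and \<open>b\<close> in base 3, leave
  room for \<open>r\<close>, so no carry occurs in either base.\<close>

lemma digit_diff_block:
  assumes "r < 2 ^ a" "r < 3 ^ b"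
  shows "digit_diff (2 ^ a * 3 ^ b * t + r)
    = int (digit_sum 2 (3 ^ b * t)) - int (digit_sum 3 (2 ^ a * t)) + digit_diff r"
  using digit_sum_power_mult_add[of 2 r a "3 ^ b * t"]
    digit_sum_power_mult_add[of 3 r b "2 ^ a * t"] assms
  by (simp add: digit_diff_def mult_ac)

text \<open>The supply of corrections: an error of either sign up to \<open>M\<close> can be
  cancelled by \<open>a\<close> low-order bits.\<close>

definition covers :: "int \<Rightarrow> nat \<Rightarrow> bool" where
  "covers M a \<longleftrightarrow> (\<forall>D. \<bar>D\<bar> \<le> M \<longrightarrow> (\<exists>r < 2 ^ a. digit_diff r = D))"

text \<open>\<open>n = 2 ^ a * 3 ^ b * (3 ^ k - 1) + r\<close> has
  \<open>digit_diff n = digit_sum 2 (3 ^ b * (3 ^ k - 1)) - 2 * k + digit_diff r\<close>. Only a binary digit sum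
  has to be computed, and this is immediate on binary numerals.\<close>

lemma covers_refine:
  assumes cov: "covers w a" and w: "w \<ge> 0"
    and step: "\<And>i. \<bar>i\<bar> \<le> m \<Longrightarrow> \<exists>b k. (2::nat) ^ a \<le> 3 ^ b \<and> (2::nat) ^ a \<le> 3 ^ k \<and>
      (2::nat) ^ a * 3 ^ b * 3 ^ k \<le> 2 ^ A \<and>
      int (digit_sum 2 (3 ^ b * (3 ^ k - 1))) - 2 * int k = (2 * w + 1) * i"
  shows "covers ((2 * w + 1) * m + w) A"
  unfolding covers_def
proof (intro allI impI)
  fix D :: int
  assume D: "\<bar>D\<bar> \<le> (2 * w + 1) * m + w"
  \<comment> \<open>Division with balanced remainder: \<open>step\<close> supplies the multiple of
    \<open>2 * w + 1\<close>, \<open>cov\<close> the rest.\<close>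
  define i where "i = (D + w) div (2 * w + 1)"
  define E where "E = (D + w) mod (2 * w + 1) - w"
  have DE: "D = (2 * w + 1) * i + E"
    by (simp add: i_def E_def algebra_simps flip: minus_mod_eq_mult_div)
  have E: "\<bar>E\<bar> \<le> w"
    using w pos_mod_bound[of "2 * w + 1" "D + w"] pos_mod_sign[of "2 * w + 1" "D + w"]
    unfolding E_def by linarith
  have "\<bar>i\<bar> \<le> m"
  proof (rule ccontr)
    assume "\<not> \<bar>i\<bar> \<le> m"
    then have "i \<ge> m + 1 \<or> i \<le> - m - 1" by linarith
    then have "(2 * w + 1) * i \<ge> (2 * w + 1) * (m + 1) \<or> (2 * w + 1) * i \<le> (2 * w + 1) * (- m - 1)"
      using w by (auto intro: mult_left_mono)
    then show False using D E unfolding DE by (auto simp: algebra_simps)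
  qed
  from step[OF this] obtain b k where bk: "(2::nat) ^ a \<le> 3 ^ b" "(2::nat) ^ a \<le> 3 ^ k"
      "(2::nat) ^ a * 3 ^ b * 3 ^ k \<le> 2 ^ A"
      "int (digit_sum 2 (3 ^ b * (3 ^ k - 1))) - 2 * int k = (2 * w + 1) * i"
    by blast
  from cov E obtain r where r: "r < 2 ^ a" "digit_diff r = E"
    unfolding covers_def by blast
  have "digit_sum 3 (2 ^ a * (3 ^ k - 1)) = 2 * k"
    using digit_sum_mult_power_minus_1[of 3 "2 ^ a" k] bk by simp
  then have "digit_diff (2 ^ a * 3 ^ b * (3 ^ k - 1) + r) = D"
    using digit_diff_block[of r a b "3 ^ k - 1"] r bk DE by simp
  moreover have "2 ^ a * 3 ^ b * (3 ^ k - 1) + r < 2 ^ A"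
  proof -
    have "(2::nat) ^ a * 3 ^ b * (3 ^ k - 1) + r < 2 ^ a * 3 ^ b * (3 ^ k - 1) + 2 ^ a * 3 ^ b"
      using r(1) by (simp add: less_le_trans)
    also have "\<dots> = 2 ^ a * 3 ^ b * 3 ^ k"
      by (simp add: diff_mult_distrib2)
    finally show ?thesis using bk(3) by linarith
  qed
  ultimately show "\<exists>r < 2 ^ A. digit_diff r = D" by blast
qed

section \<open>The first covered ranges, by explicit witnesses\<close>

lemma covers_3: "covers 3 6"
proof -
  have "\<exists>r < 2 ^ 6. digit_diff r = D" if "\<bar>D\<bar> \<le> 3" for D
  proof -
    have "digit_diff 8 = - 3" "digit_diff 20 = - 2" "digit_diff 2 = - 1" "digit_diff 0 = 0"
      "digit_diff 3 = 1" "digit_diff 30 = 2" "digit_diff 27 = 3"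
      by (simp_all add: digit_diff_def digit_sum.simps)
    moreover have "D = - 3 \<or> D = - 2 \<or> D = - 1 \<or> D = 0 \<or> D = 1 \<or> D = 2 \<or> D = 3"
      using that by linarith
    moreover have "{8, 20, 2, 0, 3, 30, 27} \<subseteq> {..<2 ^ 6 :: nat}" by simp
    ultimately show ?thesis by (metis insert_subset lessThan_iff)
  qed
  then show ?thesis by (simp add: covers_def)
qed

text \<open>The pairs \<open>(b, k)\<close> below were found by a computer search.\<close>

lemma covers_24: "covers 24 70"
proof -
  have "\<exists>b k. (2::nat) ^ 6 \<le> 3 ^ b \<and> (2::nat) ^ 6 \<le> 3 ^ k \<and> (2::nat) ^ 6 * 3 ^ b * 3 ^ k \<le> 2 ^ 70 \<and>
      int (digit_sum 2 (3 ^ b * (3 ^ k - 1))) - 2 * int k = (2 * 3 + 1) * i" (is "\<exists>b k. ?P b k i")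
    if "\<bar>i\<bar> \<le> 3" for i :: int
  proof -
    have "?P 7 18 (- 3)" by (simp add: digit_sum_2_numeral)
    moreover have "?P 5 14 (- 2)" by (simp add: digit_sum_2_numeral)
    moreover have "?P 5 9 (- 1)" by (simp add: digit_sum_2_numeral)
    moreover have "?P 5 4 0" by (simp add: digit_sum_2_numeral)
    moreover have "?P 14 4 1" by (simp add: digit_sum_2_numeral)
    moreover have "?P 23 4 2" by (simp add: digit_sum_2_numeral)
    moreover have "?P 36 4 3" by (simp add: digit_sum_2_numeral)
    moreover have "i = - 3 \<or> i = - 2 \<or> i = - 1 \<or> i = 0 \<or> i = 1 \<or> i = 2 \<or> i = 3"
      using that by presburger
    ultimately show ?thesis by blast
  qed
  from covers_refine[where m = 3, OF covers_3 _ this] show ?thesis by simp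
qed

text \<open>\<open>269 = 49 * 5 + 24\<close>. This range is wide enough to start
  \<open>covers_grow\<close>, as \<open>47 * 1200 + 22 < 270 ^ 2\<close>; the range of
  \<open>covers_24\<close> is not.\<close>

lemma covers_269: "covers 269 1200"
proof -
  have "\<exists>b k. (2::nat) ^ 70 \<le> 3 ^ b \<and> (2::nat) ^ 70 \<le> 3 ^ k \<and> (2::nat) ^ 70 * 3 ^ b * 3 ^ k \<le> 2 ^ 1200 \<and>
      int (digit_sum 2 (3 ^ b * (3 ^ k - 1))) - 2 * int k = (2 * 24 + 1) * i" (is "\<exists>b k. ?P b k i")
    if "\<bar>i\<bar> \<le> 5" for i :: int
  proof -
    have "?P 48 222 (- 5)" by (simp add: digit_sum_2_numeral)
    moreover have "?P 46 184 (- 4)" by (simp add: digit_sum_2_numeral)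
    moreover have "?P 45 161 (- 3)" by (simp add: digit_sum_2_numeral)
    moreover have "?P 45 106 (- 2)" by (simp add: digit_sum_2_numeral)
    moreover have "?P 46 67 (- 1)" by (simp add: digit_sum_2_numeral)
    moreover have "?P 62 48 0" by (simp add: digit_sum_2_numeral)
    moreover have "?P 113 45 1" by (simp add: digit_sum_2_numeral)
    moreover have "?P 182 46 2" by (simp add: digit_sum_2_numeral)
    moreover have "?P 230 49 3" by (simp add: digit_sum_2_numeral)
    moreover have "?P 295 57 4" by (simp add: digit_sum_2_numeral)
    moreover have "?P 367 52 5" by (simp add: digit_sum_2_numeral)
    moreover have "i = - 5 \<or> i = - 4 \<or> i = - 3 \<or> i = - 2 \<or> i = - 1 \<or> i = 0 \<or> i = 1 \<or> i = 2 \<or> i = 3 \<or> i = 4 \<or> i = 5"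
      using that by presburger
    ultimately show ?thesis by blast
  qed
  from covers_refine[where m = 5, OF covers_24 _ this] show ?thesis by simp
qed

subsection \<open>Second moments\<close>

lemma sum_lessThan_of_nat: "(\<Sum>j<q. real j) = real q * (real q - 1) / 2"
  by (induction q) (simp_all add: field_simps)

lemma sum_lessThan_of_nat_square:
  "(\<Sum>j<q. real j ^ 2) = real q * (real q - 1) * (2 * real q - 1) / 6"
  by (induction q) (simp_all add: field_simps power2_eq_square)

text \<open>Centred digits sum to zero, which kills the cross term with \<open>x\<close>; their
  squares have mean \<open>(q ^ 2 - 1) / 3\<close>.\<close>

lemma sum_centered_digit_square:
  "(\<Sum>j<q. (x + (2 * real j - (real q - 1))) ^ 2) = real q * x ^ 2 + real q * (real q ^ 2 - 1) / 3"
proof -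
  have "(\<Sum>j<q. (x + (2 * real j - (real q - 1))) ^ 2)
      = (\<Sum>j<q. (x - (real q - 1)) ^ 2 + (4 * (x - (real q - 1))) * real j + 4 * real j ^ 2)"
    by (intro sum.cong) (simp_all add: power2_eq_square algebra_simps)
  also have "\<dots> = real q * (x - (real q - 1)) ^ 2
      + (4 * (x - (real q - 1))) * (\<Sum>j<q. real j) + 4 * (\<Sum>j<q. real j ^ 2)"
    by (simp add: sum.distrib flip: sum_distrib_left)
  also have "\<dots> = real q * x ^ 2 + real q * (real q ^ 2 - 1) / 3"
    unfolding sum_lessThan_of_nat sum_lessThan_of_nat_square
    by (simp add: field_simps power2_eq_square)
  finally show ?thesis .
qed

text \<open>Twice the deviation of the digit sum from its mean \<open>(q - 1) * k / 2\<close> over \<open>{..<q ^ k}\<close>.\<close>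

definition digit_dev :: "nat \<Rightarrow> nat \<Rightarrow> nat \<Rightarrow> real" where
  "digit_dev q k n = 2 * real (digit_sum q n) - (real q - 1) * real k"

text \<open>The digits of a uniformly chosen number are independent, so variances add; the induction
  splits off the last digit.\<close>

lemma sum_digit_dev_square:
  assumes "q \<ge> 2"
  shows "(\<Sum>l<q ^ k. digit_dev q k l ^ 2) = real (q ^ k) * real k * ((real q ^ 2 - 1) / 3)"
proof (induction k)
  case 0
  then show ?case by (simp add: digit_dev_def)
next
  case (Suc k)
  have "(\<Sum>l<q ^ Suc k. digit_dev q (Suc k) l ^ 2)
      = (\<Sum>m<q ^ k. \<Sum>l = m * q..<m * q + q. digit_dev q (Suc k) l ^ 2)"
    by (simp add: sum.nat_group mult.commute)
  also have "\<dots> = (\<Sum>m<q ^ k. real q * digit_dev q k m ^ 2 + real q * (real q ^ 2 - 1) / 3)"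
  proof (rule sum.cong[OF refl])
    fix m
    have "(\<Sum>l = m * q..<m * q + q. digit_dev q (Suc k) l ^ 2)
        = (\<Sum>j<q. digit_dev q (Suc k) (q * m + j) ^ 2)"
      using sum.shift_bounds_nat_ivl[of "\<lambda>l. digit_dev q (Suc k) l ^ 2" 0 "m * q" q]
      by (simp add: atLeast0LessThan add.commute mult.commute)
    also have "\<dots> = (\<Sum>j<q. (digit_dev q k m + (2 * real j - (real q - 1))) ^ 2)"
    proof (rule sum.cong[OF refl])
      fix j assume "j \<in> {..<q}"
      then have "digit_sum q (q * m + j) = digit_sum q m + j"
        using digit_sum_power_mult_add[of q j 1 m] assms by (simp add: digit_sum_less)
      then show "digit_dev q (Suc k) (q * m + j) ^ 2
          = (digit_dev q k m + (2 * real j - (real q - 1))) ^ 2"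
        by (simp add: digit_dev_def algebra_simps)
    qed
    finally show "(\<Sum>l = m * q..<m * q + q. digit_dev q (Suc k) l ^ 2)
        = real q * digit_dev q k m ^ 2 + real q * (real q ^ 2 - 1) / 3"
      by (simp only: sum_centered_digit_square)
  qed
  also have "\<dots> = real q * (\<Sum>m<q ^ k. digit_dev q k m ^ 2)
      + real (q ^ k) * (real q * (real q ^ 2 - 1) / 3)"
    by (simp add: sum.distrib sum_distrib_left)
  also have "\<dots> = real (q ^ Suc k) * real (Suc k) * ((real q ^ 2 - 1) / 3)"
    unfolding Suc.IH by (simp add: field_simps)
  finally show ?case .
qed

text \<open>Transfers second moments from all values of a digit block to those taken by that block
  of \<open>d * t\<close>.\<close>

lemma sum_comp_le:
  fixes f :: "'b \<Rightarrow> real"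
  assumes "finite A" "finite B" "g ` A \<subseteq> B" "\<And>y. y \<in> B \<Longrightarrow> f y \<ge> 0"
    and "\<And>y. y \<in> B \<Longrightarrow> real (card {x \<in> A. g x = y}) \<le> c"
  shows "(\<Sum>x\<in>A. f (g x)) \<le> c * (\<Sum>y\<in>B. f y)"
proof -
  have "(\<Sum>x\<in>A. f (g x)) = (\<Sum>y\<in>B. \<Sum>x | x \<in> A \<and> g x = y. f (g x))"
    using assms(1-3) by (intro sum.group[symmetric])
  also have "\<dots> = (\<Sum>y\<in>B. real (card {x \<in> A. g x = y}) * f y)"
    by (intro sum.cong) simp_all
  also have "\<dots> \<le> (\<Sum>y\<in>B. c * f y)"
    using assms(4,5) by (intro sum_mono mult_right_mono)
  finally show ?thesis by (simp add: sum_distrib_left)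
qed

text \<open>By coprimality the residue determines \<open>t mod Q\<close>, so \<open>t div Q\<close>
  separates the elements of a fibre.\<close>

lemma card_mult_mod_eq_le:
  assumes "coprime d Q" "Q > 0"
  shows "real (card {t \<in> {..<T}. (d * t) mod Q = l}) \<le> real T / real Q + 1"
proof -
  have "inj_on (\<lambda>t. t div Q) {t \<in> {..<T}. (d * t) mod Q = l}"
  proof (rule inj_onI)
    fix t t' assume t: "t \<in> {t \<in> {..<T}. (d * t) mod Q = l}"
      and t': "t' \<in> {t \<in> {..<T}. (d * t) mod Q = l}" and eq: "t div Q = t' div Q"
    have "[d * t = d * t'] (mod Q)"
      using t t' by (simp add: cong_def)
    then have "t mod Q = t' mod Q"
      using assms(1) cong_mult_lcancel_nat unfolding cong_def by blast
    with eq show "t = t'" by (metis div_mod_decomp)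
  qed
  moreover have "(\<lambda>t. t div Q) ` {t \<in> {..<T}. (d * t) mod Q = l} \<subseteq> {..T div Q}"
    by (auto intro: div_le_mono)
  ultimately have "card {t \<in> {..<T}. (d * t) mod Q = l} \<le> card {..T div Q}"
    by (rule card_inj_on_le) simp
  then have "real (card {t \<in> {..<T}. (d * t) mod Q = l}) \<le> real (T div Q) + 1"
    by simp
  also have "real (T div Q) \<le> real T / real Q"
    by (rule of_nat_div_le_of_nat)
  finally show ?thesis by simp
qed

text \<open>A fibre confines \<open>d * t\<close> to a window of length \<open>Q\<close>, hence
  \<open>t\<close> to one of length about \<open>Q / d\<close>.\<close>

lemma card_mult_div_eq_le:
  assumes "d > 0" "Q > 0"
  shows "real (card {t \<in> {..<T}. (d * t) div Q = u}) \<le> real Q / real d + 1"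
proof (cases "{t \<in> {..<T}. (d * t) div Q = u} = {}")
  case False
  define t0 where "t0 = Min {t \<in> {..<T}. (d * t) div Q = u}"
  have t0: "t0 \<in> {t \<in> {..<T}. (d * t) div Q = u}"
    unfolding t0_def using False by (intro Min_in) auto
  have "{t \<in> {..<T}. (d * t) div Q = u} \<subseteq> {t0..t0 + Q div d}"
  proof
    fix t assume t: "t \<in> {t \<in> {..<T}. (d * t) div Q = u}"
    then have le: "t0 \<le> t" unfolding t0_def by (intro Min_le) auto
    have "d * t < u * Q + Q" "u * Q \<le> d * t0"
      using t t0 dividend_less_div_times[OF assms(2), of "d * t"]
        div_times_less_eq_dividend[of "d * t0" Q] by auto
    then have "d * t < Q + d * t0"
      by linarith
    then have "d * (t - t0) < Q"
      using le by (simp add: diff_mult_distrib2 less_diff_conv2)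
    then have "t - t0 \<le> Q div d"
      using assms(1) by (simp add: less_eq_div_iff_mult_less_eq mult.commute)
    then show "t \<in> {t0..t0 + Q div d}" using le by simp
  qed
  then have "card {t \<in> {..<T}. (d * t) div Q = u} \<le> card {t0..t0 + Q div d}"
    by (intro card_mono) auto
  then have "real (card {t \<in> {..<T}. (d * t) div Q = u}) \<le> real (Q div d) + 1"
    by simp
  also have "real (Q div d) \<le> real Q / real d"
    by (rule of_nat_div_le_of_nat)
  finally show ?thesis by simp
next
  case True
  then show ?thesis by (simp only: card.empty) simp
qed

text \<open>The \<open>i\<close> low-order and the \<open>j\<close> high-order digits of \<open>d * t\<close> are treated separately: as
  \<open>q ^ i \<le> T\<close> and \<open>q ^ j \<le> T\<close>, each possible value of either half is taken about as often as
  under equidistribution, up to a constant factor.\<close>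

lemma sum_digit_dev_mult_square_le:
  assumes q: "q \<ge> 2" and d: "d > 0" "coprime d q"
    and T: "d * T \<le> q ^ (i + j)" "q ^ (i + j) \<le> 3 * (d * T)" "q ^ i \<le> T" "q ^ j \<le> T"
  shows "(\<Sum>t<T. digit_dev q (i + j) (d * t) ^ 2)
    \<le> real T * (4 * (real i + 2 * real j) * ((real q ^ 2 - 1) / 3))"
proof -
  define V where "V = (real q ^ 2 - 1) / 3"
  have V: "V \<ge> 0" using q unfolding V_def by simp
  have q0: "q ^ i > 0" "q ^ j > 0" using q by simp_all
  have split: "digit_dev q (i + j) n = digit_dev q i (n mod q ^ i) + digit_dev q j (n div q ^ i)" for n
    using digit_sum_div_mod_power[OF q, of n i] by (simp add: digit_dev_def algebra_simps)
  have low: "(\<Sum>t<T. digit_dev q i ((d * t) mod q ^ i) ^ 2) \<le> 2 * real T * real i * V"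
  proof -
    have "(\<Sum>t<T. digit_dev q i ((d * t) mod q ^ i) ^ 2)
        \<le> (real T / real (q ^ i) + 1) * (\<Sum>l<q ^ i. digit_dev q i l ^ 2)"
      using q0 d by (intro sum_comp_le card_mult_mod_eq_le) auto
    also have "\<dots> = (real T + real (q ^ i)) * (real i * V)"
      unfolding sum_digit_dev_square[OF q] using q0 by (simp add: V_def field_simps)
    also have "\<dots> \<le> (real T + real T) * (real i * V)"
      using T V by (intro mult_right_mono add_left_mono) (auto simp flip: of_nat_power)
    finally show ?thesis by simp
  qed
  have high: "(\<Sum>t<T. digit_dev q j ((d * t) div q ^ i) ^ 2) \<le> 4 * real T * real j * V"
  proof -
    have "(d * t) div q ^ i < q ^ j" if "t < T" for t
    proof -
      have "d * t < q ^ (i + j)"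
        using that d(1) T(1) by (meson less_le_trans mult_less_mono2)
      then have "d * t < q ^ j * q ^ i"
        by (simp add: power_add mult.commute)
      then show ?thesis by (rule less_mult_imp_div_less)
    qed
    then have "(\<Sum>t<T. digit_dev q j ((d * t) div q ^ i) ^ 2)
        \<le> (real (q ^ i) / real d + 1) * (\<Sum>u<q ^ j. digit_dev q j u ^ 2)"
      using q0 d by (intro sum_comp_le card_mult_div_eq_le) auto
    also have "\<dots> = (real (q ^ (i + j)) / real d + real (q ^ j)) * (real j * V)"
      unfolding sum_digit_dev_square[OF q] V_def[symmetric]
      by (simp add: power_add ring_distribs mult_ac)
    also have "\<dots> \<le> (3 * real T + real T) * (real j * V)"
    proof (intro mult_right_mono add_mono)
      have "real (q ^ (i + j)) \<le> real (3 * (d * T))" using T(2) by (rule of_nat_mono)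
      then show "real (q ^ (i + j)) / real d \<le> 3 * real T"
        using d by (simp add: field_simps)
    qed (use T V in \<open>auto simp flip: of_nat_power\<close>)
    finally show ?thesis by simp
  qed
  \<comment> \<open>The two blocks may be correlated; a factor 2 avoids estimating their
    covariance.\<close>
  have "(\<Sum>t<T. digit_dev q (i + j) (d * t) ^ 2)
      \<le> (\<Sum>t<T. 2 * digit_dev q i ((d * t) mod q ^ i) ^ 2 + 2 * digit_dev q j ((d * t) div q ^ i) ^ 2)"
  proof (rule sum_mono)
    fix t
    have "(x + y) ^ 2 \<le> 2 * x ^ 2 + 2 * y ^ 2" for x y :: real
      using zero_le_power2[of "x - y"] by (simp add: power2_eq_square algebra_simps)
    then show "digit_dev q (i + j) (d * t) ^ 2
        \<le> 2 * digit_dev q i ((d * t) mod q ^ i) ^ 2 + 2 * digit_dev q j ((d * t) div q ^ i) ^ 2"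
      unfolding split[of "d * t"] .
  qed
  also have "\<dots> \<le> 2 * (2 * real T * real i * V) + 2 * (4 * real T * real j * V)"
    unfolding sum.distrib sum_distrib_left[symmetric] by (intro add_mono mult_left_mono low high) simp_all
  finally show ?thesis unfolding V_def[symmetric] by (simp add: algebra_simps)
qed

subsection \<open>From approximate to exact differences\<close>

text \<open>The next two lemmas enclose \<open>log 3 2\<close> between \<open>5 / 8\<close> and \<open>12 / 19\<close>.\<close>

lemma pow3_le_pow2_imp:
  assumes "(3::nat) ^ x \<le> 2 ^ y" shows "19 * x \<le> 12 * y"
proof -
  have "((3::nat) ^ x) ^ 19 \<le> (2 ^ y) ^ 19"
    using assms by (rule power_mono) simp
  also have "((2::nat) ^ y) ^ 19 = (2 ^ 19) ^ y"
    by (simp only: power_mult[symmetric] mult.commute)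
  also have "\<dots> \<le> (3 ^ 12) ^ y"
    by (rule power_mono) simp_all
  finally have "(3::nat) ^ (19 * x) \<le> 3 ^ (12 * y)"
    by (simp only: power_mult[symmetric] mult.commute)
  then show ?thesis by (rule power_le_imp_le_exp[rotated]) simp
qed

lemma pow2_le_pow3_imp:
  assumes "(2::nat) ^ x \<le> 3 ^ y" shows "5 * x \<le> 8 * y"
proof -
  have "((2::nat) ^ x) ^ 5 \<le> (3 ^ y) ^ 5"
    using assms by (rule power_mono) simp
  also have "((3::nat) ^ y) ^ 5 = (3 ^ 5) ^ y"
    by (simp only: power_mult[symmetric] mult.commute)
  also have "\<dots> \<le> (2 ^ 8) ^ y"
    by (rule power_mono) simp_all
  finally have "(2::nat) ^ (5 * x) \<le> 2 ^ (8 * y)"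
    by (simp only: power_mult[symmetric] mult.commute)
  then show ?thesis by (rule power_le_imp_le_exp[rotated]) simp
qed

text \<open>With \<open>\<tau> + e\<close> bits for \<open>3 ^ b * t\<close> and \<open>K\<close>
  ternary digits for \<open>2 ^ a * t\<close>, the mean digit sums are
  \<open>(\<tau> + e) / 2\<close> and \<open>K\<close>. Their difference is \<open>D\<close>, so the
  deviation is half a difference of two \<open>digit_dev\<close> values.\<close>

lemma sum_block_deviation_square_le:
  assumes ae: "a + 2 \<le> e" "e \<le> \<tau>" "a + 4 \<le> \<tau>"
    and K: "(2::nat) ^ (a + \<tau>) \<le> 3 ^ K" "(3::nat) ^ K \<le> 3 * 2 ^ (a + \<tau>)"
    and D: "2 * D = int e + int \<tau> - 2 * int K"
    and b: "(3::nat) ^ b \<le> 2 ^ e" "(2::nat) ^ e \<le> 3 * 3 ^ b"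
  shows "(\<Sum>t<2 ^ \<tau>. real_of_int (int (digit_sum 2 (3 ^ b * t)) - int (digit_sum 3 (2 ^ a * t)) - D) ^ 2)
    \<le> 2 ^ \<tau> * (6 * real \<tau> + 4 * real e + 7 * real a + 22)"
proof -
  obtain i where i: "(3::nat) ^ i \<le> 2 ^ \<tau>" "(2::nat) ^ \<tau> < 3 ^ (i + 1)"
    using ex_power_ivl1[of 3 "2 ^ \<tau>"] by auto
  have "(2::nat) ^ \<tau> \<le> 2 ^ (a + \<tau>)"
    by (intro power_increasing) auto
  then have "(3::nat) ^ i \<le> 3 ^ K"
    using i(1) K(1) by linarith
  then have "i \<le> K" by simp
  \<comment> \<open>The top \<open>j\<close> ternary digits are roughly those contributed by the
    factor \<open>2 ^ a\<close>.\<close>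
  define j where "j = K - i"
  have Kij: "K = i + j" using \<open>i \<le> K\<close> by (simp add: j_def)
  have "3 ^ j * (2::nat) ^ \<tau> < 3 ^ j * 3 ^ (i + 1)"
    using i(2) by simp
  also have "\<dots> = 3 * 3 ^ K" by (simp add: Kij power_add)
  also have "\<dots> \<le> 9 * 2 ^ a * 2 ^ \<tau>"
    using K(2) by (simp add: power_add mult_ac)
  finally have j9: "(3::nat) ^ j < 9 * 2 ^ a"
    by simp
  have "9 * (2::nat) ^ a \<le> 2 ^ (a + 4)" by (simp add: power_add)
  also have "\<dots> \<le> 2 ^ \<tau>" using ae by (intro power_increasing) auto
  finally have jT: "(3::nat) ^ j \<le> 2 ^ \<tau>" using j9 by simp
  have j19: "19 * j \<le> 12 * a + 38"
  proof (cases "j \<ge> 2")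
    case True
    then obtain j' where j': "j = j' + 2" using le_Suc_ex by (metis add.commute)
    have "(3::nat) ^ j' \<le> 2 ^ a" using j9 unfolding j' by (simp add: power_add)
    from pow3_le_pow2_imp[OF this] show ?thesis unfolding j' by simp
  qed simp
  have i19: "19 * i \<le> 12 * \<tau>" by (rule pow3_le_pow2_imp[OF i(1)])
  define x where "x t = digit_dev 2 (\<tau> + e) (3 ^ b * t)" for t
  define y where "y t = digit_dev 3 (i + j) (2 ^ a * t)" for t
  have "(\<Sum>t<2 ^ \<tau>. x t ^ 2) \<le> real (2 ^ \<tau>) * (4 * (real \<tau> + 2 * real e) * ((real 2 ^ 2 - 1) / 3))"
    unfolding x_def using b ae
    by (intro sum_digit_dev_mult_square_le) (auto simp: power_add intro: power_increasing)
  then have X: "(\<Sum>t<2 ^ \<tau>. x t ^ 2) \<le> 2 ^ \<tau> * (4 * (real \<tau> + 2 * real e))" by simp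
  have "(\<Sum>t<2 ^ \<tau>. y t ^ 2) \<le> real (2 ^ \<tau>) * (4 * (real i + 2 * real j) * ((real 3 ^ 2 - 1) / 3))"
    unfolding y_def using K i(1) jT
    by (intro sum_digit_dev_mult_square_le) (auto simp: Kij power_add)
  then have Y: "(\<Sum>t<2 ^ \<tau>. y t ^ 2) \<le> 2 ^ \<tau> * (32 / 3 * (real i + 2 * real j))" by simp
  have "(\<Sum>t<2 ^ \<tau>. real_of_int (int (digit_sum 2 (3 ^ b * t)) - int (digit_sum 3 (2 ^ a * t)) - D) ^ 2)
      \<le> (\<Sum>t<2 ^ \<tau>. (x t ^ 2 + y t ^ 2) / 2)"
  proof (rule sum_mono)
    fix t :: nat
    have "2 * real_of_int D = real e + real \<tau> - 2 * (real i + real j)"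
      using arg_cong[OF D, of real_of_int] by (simp add: Kij)
    then have eq: "real_of_int (int (digit_sum 2 (3 ^ b * t)) - int (digit_sum 3 (2 ^ a * t)) - D)
        = (x t - y t) / 2"
      by (simp add: x_def y_def digit_dev_def algebra_simps)
    show "real_of_int (int (digit_sum 2 (3 ^ b * t)) - int (digit_sum 3 (2 ^ a * t)) - D) ^ 2
        \<le> (x t ^ 2 + y t ^ 2) / 2"
      unfolding eq using zero_le_power2[of "x t + y t"]
      by (simp add: power2_eq_square algebra_simps)
  qed
  also have "\<dots> = ((\<Sum>t<2 ^ \<tau>. x t ^ 2) + (\<Sum>t<2 ^ \<tau>. y t ^ 2)) / 2"
    by (simp add: sum.distrib flip: sum_divide_distrib)
  also have "\<dots> \<le> (2 ^ \<tau> * (4 * (real \<tau> + 2 * real e)) + 2 ^ \<tau> * (32 / 3 * (real i + 2 * real j))) / 2"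
    using X Y by simp
  also have "\<dots> = 2 ^ \<tau> * (2 * real \<tau> + 4 * real e + 16 / 3 * (real i + 2 * real j))"
    by (simp add: algebra_simps)
  \<comment> \<open>Rounding up: \<open>2 + 64 / 19 \<le> 6\<close>, \<open>128 / 19 \<le> 7\<close>
    and \<open>64 / 3 \<le> 22\<close>.\<close>
  also have "\<dots> \<le> 2 ^ \<tau> * (6 * real \<tau> + 4 * real e + 7 * real a + 22)"
  proof (rule mult_left_mono)
    have "19 * real i \<le> 12 * real \<tau>" using i19 by linarith
    moreover have "19 * real j \<le> 12 * real a + 38" using j19 by linarith
    moreover have "real \<tau> \<ge> 0" "real a \<ge> 0" by simp_all
    ultimately show "2 * real \<tau> + 4 * real e + 16 / 3 * (real i + 2 * real j)
        \<le> 6 * real \<tau> + 4 * real e + 7 * real a + 22"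
      by (simp add: field_simps)
  qed simp
  finally show ?thesis .
qed

text \<open>Chebyshev's inequality for the high-order part of \<open>n = 2 ^ a * 3 ^ b * t + r\<close>: whenever its
  contribution is within \<open>M\<close> of \<open>D\<close>, a low-order part \<open>r\<close> corrects it to exactly \<open>D\<close>.\<close>

lemma card_digit_diff_eq_ge:
  assumes cov: "covers M a" and M: "M \<ge> 0"
    and ae: "a + 2 \<le> e" "e \<le> \<tau>" "a + 4 \<le> \<tau>"
    and K: "(2::nat) ^ (a + \<tau>) \<le> 3 ^ K" "(3::nat) ^ K \<le> 3 * 2 ^ (a + \<tau>)"
    and D: "2 * D = int e + int \<tau> - 2 * int K"
  shows "(2 ^ \<tau> - real (card {n. n < 2 ^ (a + e + \<tau>) \<and> digit_diff n = D})) * (real_of_int M + 1) ^ 2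
    \<le> 2 ^ \<tau> * (6 * real \<tau> + 4 * real e + 7 * real a + 22)"
proof -
  obtain b where b: "(3::nat) ^ b \<le> 2 ^ e" "(2::nat) ^ e < 3 ^ (b + 1)"
    using ex_power_ivl1[of 3 "2 ^ e"] by auto
  \<comment> \<open>The two spare bits in \<open>a + 2 \<le> e\<close> absorb the factor 3 lost in
    choosing \<open>b\<close>, so \<open>r < 2 ^ a\<close> also fits into \<open>b\<close> ternary
    digits.\<close>
  have "4 * (2::nat) ^ a \<le> 2 ^ e"
    using power_increasing[of "a + 2" e "2::nat"] ae by (simp add: power_add)
  then have ab: "(2::nat) ^ a \<le> 3 ^ b"
    using b by simp
  define F where "F t = int (digit_sum 2 (3 ^ b * t)) - int (digit_sum 3 (2 ^ a * t)) - D" for t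
  define G where "G = {t \<in> {..<2 ^ \<tau>}. \<bar>F t\<bar> \<le> M}"
  define B where "B = {t \<in> {..<2 ^ \<tau>}. \<not> \<bar>F t\<bar> \<le> M}"
  have "card G + card B = 2 ^ \<tau>"
  proof -
    have "G \<union> B = {..<2 ^ \<tau>}" "G \<inter> B = {}" "finite G" "finite B"
      by (auto simp: G_def B_def)
    then show ?thesis by (metis card_Un_disjoint card_lessThan)
  qed
  then have GB: "real (card B) = 2 ^ \<tau> - real (card G)"
    by (metis add_diff_cancel_left' of_nat_add of_nat_numeral of_nat_power)
  have "real (card B) * (real_of_int M + 1) ^ 2 = (\<Sum>t\<in>B. (real_of_int M + 1) ^ 2)"
    by simp
  also have "\<dots> \<le> (\<Sum>t\<in>B. real_of_int (F t) ^ 2)"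
  proof (rule sum_mono)
    fix t assume "t \<in> B"
    then have "M + 1 \<le> \<bar>F t\<bar>" by (simp add: B_def)
    then have "(M + 1) ^ 2 \<le> \<bar>F t\<bar> ^ 2" using M by (intro power_mono) auto
    then have "real_of_int ((M + 1) ^ 2) \<le> real_of_int (\<bar>F t\<bar> ^ 2)"
      by (rule of_int_le_iff[THEN iffD2])
    then show "(real_of_int M + 1) ^ 2 \<le> real_of_int (F t) ^ 2"
      by simp
  qed
  also have "\<dots> \<le> (\<Sum>t<2 ^ \<tau>. real_of_int (F t) ^ 2)"
    by (rule sum_mono2) (auto simp: B_def)
  also have "\<dots> \<le> 2 ^ \<tau> * (6 * real \<tau> + 4 * real e + 7 * real a + 22)"
    unfolding F_def using b ae K D by (intro sum_block_deviation_square_le) auto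
  finally have cheb: "(2 ^ \<tau> - real (card G)) * (real_of_int M + 1) ^ 2
      \<le> 2 ^ \<tau> * (6 * real \<tau> + 4 * real e + 7 * real a + 22)"
    unfolding GB .
  have "\<exists>r. r < 2 ^ a \<and> digit_diff r = - F t" if "t \<in> G" for t
    using cov that unfolding covers_def G_def by auto
  then obtain r where r: "\<And>t. t \<in> G \<Longrightarrow> r t < 2 ^ a \<and> digit_diff (r t) = - F t"
    by metis
  \<comment> \<open>Division by \<open>2 ^ a * 3 ^ b\<close> recovers \<open>t\<close>, so good
    \<open>t\<close> give distinct \<open>n\<close>.\<close>
  have "card G \<le> card {n. n < 2 ^ (a + e + \<tau>) \<and> digit_diff n = D}"
  proof (rule card_inj_on_le)
    have rlt: "r t < 2 ^ a * 3 ^ b" if "t \<in> G" for t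
    proof -
      have "r t < 2 ^ a * 1" using r[OF that] by simp
      also have "\<dots> \<le> 2 ^ a * 3 ^ b" by (intro mult_le_mono2) simp
      finally show ?thesis .
    qed
    show "inj_on (\<lambda>t. 2 ^ a * 3 ^ b * t + r t) G"
    proof (rule inj_onI)
      fix t u assume t: "t \<in> G" and u: "u \<in> G" and eq: "2 ^ a * 3 ^ b * t + r t = 2 ^ a * 3 ^ b * u + r u"
      have "(2 ^ a * 3 ^ b * t + r t) div (2 ^ a * 3 ^ b) = t"
        "(2 ^ a * 3 ^ b * u + r u) div (2 ^ a * 3 ^ b) = u"
        using rlt[OF t] rlt[OF u] by (simp_all add: div_mult_self4)
      then show "t = u" using eq by metis
    qed
    show "(\<lambda>t. 2 ^ a * 3 ^ b * t + r t) ` G \<subseteq> {n. n < 2 ^ (a + e + \<tau>) \<and> digit_diff n = D}"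
    proof (rule image_subsetI)
      fix t assume t: "t \<in> G"
      then have "Suc t \<le> 2 ^ \<tau>" by (simp add: G_def)
      have "2 ^ a * 3 ^ b * t + r t < 2 ^ a * 3 ^ b * Suc t"
        using rlt[OF t] by simp
      also have "\<dots> \<le> 2 ^ a * 2 ^ e * 2 ^ \<tau>"
        using b(1) \<open>Suc t \<le> 2 ^ \<tau>\<close> by (intro mult_le_mono) auto
      also have "\<dots> = 2 ^ (a + e + \<tau>)" by (simp add: power_add)
      finally have "2 ^ a * 3 ^ b * t + r t < 2 ^ (a + e + \<tau>)" .
      moreover have "digit_diff (2 ^ a * 3 ^ b * t + r t) = D"
        using digit_diff_block[of "r t" a b t] r[OF t] ab by (simp add: F_def)
      ultimately show "2 ^ a * 3 ^ b * t + r t \<in> {n. n < 2 ^ (a + e + \<tau>) \<and> digit_diff n = D}"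
        by simp
    qed
  qed simp
  then have "(2 ^ \<tau> - real (card {n. n < 2 ^ (a + e + \<tau>) \<and> digit_diff n = D})) * (real_of_int M + 1) ^ 2
      \<le> (2 ^ \<tau> - real (card G)) * (real_of_int M + 1) ^ 2"
    by (intro mult_right_mono) simp_all
  then show ?thesis using cheb by linarith
qed

section \<open>Bootstrapping the covered range\<close>

lemma ex_pow3_between:
  assumes "n \<ge> 1"
  shows "\<exists>K. n \<le> 3 ^ K \<and> (3::nat) ^ K \<le> 3 * n"
proof -
  obtain k where "(3::nat) ^ k \<le> 3 * n" "3 * n < 3 ^ (k + 1)"
    using ex_power_ivl1[of 3 "3 * n"] assms by auto
  then show ?thesis by (intro exI[of _ k]) simp
qed

lemma pow3_exponent_bounds:
  assumes "(2::nat) ^ m \<le> 3 ^ K" "(3::nat) ^ K \<le> 3 * 2 ^ m"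
  shows "5 * m \<le> 8 * K" "19 * K \<le> 12 * m + 19"
proof -
  show "5 * m \<le> 8 * K" by (rule pow2_le_pow3_imp[OF assms(1)])
  show "19 * K \<le> 12 * m + 19"
  proof (cases K)
    case (Suc k)
    then have "(3::nat) ^ k \<le> 2 ^ m" using assms(2) by simp
    from pow3_le_pow2_imp[OF this] show ?thesis by (simp add: Suc)
  qed simp
qed

text \<open>Take \<open>\<tau> = 4 * a\<close> and choose \<open>e\<close> to make the difference of
  means equal to the target. As \<open>e \<le> 4 * a\<close>, the variance bound has
  \<open>47 = 6 * 4 + 4 * 4 + 7\<close>, and \<open>big\<close> lets at least one \<open>t\<close>
  survive Chebyshev's inequality.\<close>

lemma covers_grow:
  assumes cov: "covers M a" and M: "M \<ge> 0" and a: "a \<ge> 2"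
    and big: "47 * int a + 22 < (M + 1) ^ 2" and M': "8 * (M' + 1) \<le> 5 * int a"
  shows "covers M' (9 * a)"
  unfolding covers_def
proof (intro allI impI)
  fix D :: int assume D: "\<bar>D\<bar> \<le> M'"
  obtain K where K: "(2::nat) ^ (a + 4 * a) \<le> 3 ^ K" "(3::nat) ^ K \<le> 3 * 2 ^ (a + 4 * a)"
    using ex_pow3_between[of "2 ^ (a + 4 * a)"] by auto
  define e where "e = nat (2 * D + 2 * int K - 4 * int a)"
  from pow3_exponent_bounds[OF K] have "25 * int a \<le> 8 * int K" "19 * int K \<le> 60 * int a + 19"
    by auto
  \<comment> \<open>The lower bound is exact: \<open>2 * K \<ge> 25 * a / 4\<close> and
    \<open>2 * D \<ge> 2 - 5 * a / 4\<close>.\<close>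
  then have "int a + 2 \<le> 2 * D + 2 * int K - 4 * int a"
    and "2 * D + 2 * int K - 4 * int a \<le> 4 * int a"
    using D M' by auto
  note e = this
  then have e_eq: "int e = 2 * D + 2 * int K - 4 * int a" by (simp add: e_def)
  define S where "S = {n. n < (2::nat) ^ (a + e + 4 * a) \<and> digit_diff n = D}"
  have le: "(2 ^ (4 * a) - real (card S)) * (real_of_int M + 1) ^ 2
      \<le> 2 ^ (4 * a) * (6 * real (4 * a) + 4 * real e + 7 * real a + 22)"
    unfolding S_def using cov M K e e_eq a by (intro card_digit_diff_eq_ge) auto
  have e4: "e \<le> 4 * a" using e e_eq by linarith
  have "S \<noteq> {}"
  proof
    assume "S = {}"
    then have "2 ^ (4 * a) * (real_of_int M + 1) ^ 2 
        \<le> 2 ^ (4 * a) * (6 * real (4 * a) + 4 * real e + 7 * real a + 22)"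
      using le by simp
    then have "(real_of_int M + 1) ^ 2 \<le> 6 * real (4 * a) + 4 * real e + 7 * real a + 22"
      by simp
    also have "\<dots> \<le> 47 * real a + 22" using e4 by simp
    also have "\<dots> = real_of_int (47 * int a + 22)" by simp
    also have "\<dots> < real_of_int ((M + 1) ^ 2)" using big by (subst of_int_less_iff)
    finally show False by simp
  qed
  then obtain n where "n < 2 ^ (a + e + 4 * a)" "digit_diff n = D" by (auto simp: S_def)
  moreover have "(2::nat) ^ (a + e + 4 * a) \<le> 2 ^ (9 * a)"
    using e4 by (intro power_increasing) auto
  ultimately show "\<exists>r<2 ^ (9 * a). digit_diff r = D" by (blast intro: less_le_trans)
qed

text \<open>The ratio \<open>720 / 10800 = 1 / 15\<close> lies below \<open>5 / 72\<close>, the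
  limit of what \<open>covers_grow\<close> yields, so it reproduces itself.\<close>

lemma covers_linear: "covers (int (720 * 9 ^ k)) (10800 * 9 ^ k)"
proof (induction k)
  case 0
  show ?case using covers_grow[OF covers_269, of 720] by simp
next
  case (Suc k)
  define m :: nat where "m = 9 ^ k"
  have m: "m \<ge> 1" by (simp add: m_def)
  have "covers (int (720 * (9 * m))) (9 * (10800 * m))"
  proof (rule covers_grow)
    show "covers (int (720 * m)) (10800 * m)" using Suc.IH by (simp add: m_def)
    have "507600 * int m + 22 < (720 * int m) ^ 2 + 1440 * int m"
    proof -
      have "int m \<le> (int m) ^ 2"
        using m by (simp add: power2_eq_square)
      moreover have "(720 * int m) ^ 2 = 518400 * (int m) ^ 2"
        by (simp add: power_mult_distrib)
      ultimately show ?thesis using m by linarith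
    qed
    then show "47 * int (10800 * m) + 22 < (int (720 * m) + 1) ^ 2"
      by (simp add: power2_eq_square algebra_simps)
  qed (use m in auto)
  then show ?case by (simp add: m_def mult_ac)
qed

subsection \<open>Counting collisions\<close>

text \<open>With \<open>a\<close> of order \<open>\<eta> * \<tau>\<close> the available corrections
  are linear in \<open>\<tau>\<close>, while typical deviations are of order
  \<open>sqrt \<tau>\<close>; so half of all \<open>t\<close> survive once \<open>\<tau>\<close> is
  large.\<close>

lemma card_digit_diff_0_ge:
  fixes \<eta> :: real
  assumes \<eta>: "0 < \<eta>" "\<eta> \<le> 1 / 4"
  defines "\<kappa> \<equiv> 2 * ln 2 / ln 3 + 4 * \<eta>"
  shows "\<exists>\<tau>0. \<forall>\<tau>\<ge>\<tau>0. \<forall>N. 2 powr (\<kappa> * real \<tau>) \<le> real N \<longrightarrow>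
    2 ^ \<tau> \<le> 2 * card {n. n < N \<and> digit_diff n = 0}"
proof -
  \<comment> \<open>The summands ensure
    \<open>26 * \<tau> \<le> (\<eta> * \<tau> / 135) ^ 2\<close>, \<open>m \<ge> 1\<close> and
    \<open>22 \<le> \<tau>\<close>.\<close>
  define C where "C = 26 * 135 ^ 2 / \<eta> ^ 2 + 10800 / \<eta> + 22"
  have "2 ^ \<tau> \<le> 2 * card {n. n < N \<and> digit_diff n = 0}"
    if \<tau>: "\<tau> \<ge> nat \<lceil>C\<rceil>" and N: "2 powr (\<kappa> * real \<tau>) \<le> real N" for \<tau> N
  proof -
    have "26 * 135 ^ 2 / \<eta> ^ 2 \<ge> 0" "10800 / \<eta> \<ge> 0" using \<eta> by simp_all
    moreover have "real \<tau> \<ge> C" using \<tau> by linarith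
    ultimately have T1: "real \<tau> \<ge> 26 * 135 ^ 2 / \<eta> ^ 2" and T2: "real \<tau> \<ge> 10800 / \<eta>" and T3: "real \<tau> \<ge> 22"
      unfolding C_def by linarith+
    have \<eta>\<tau>: "\<eta> * real \<tau> \<ge> 10800"
      using T2 \<eta> by (simp add: field_simps)
    define m where "m = nat \<lfloor>\<eta> * real \<tau> / 10800\<rfloor>"
    have m: "real m \<le> \<eta> * real \<tau> / 10800" "\<eta> * real \<tau> / 10800 < real m + 1" "m \<ge> 1"
      using \<eta>\<tau> unfolding m_def by linarith+
    obtain k where k: "9 ^ k \<le> m" "m < 9 ^ (k + 1)"
      using ex_power_ivl1[of 9 m] m(3) by auto
    define a where "a = 10800 * (9::nat) ^ k"
    define M where "M = int (720 * 9 ^ k)"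
    have cov: "covers M a" unfolding a_def M_def by (rule covers_linear)
    have "real (9 ^ k) \<le> real m" using k(1) by (rule of_nat_mono)
    moreover have "real a = 10800 * real (9 ^ k)" by (simp add: a_def)
    ultimately have a_le: "real a \<le> \<eta> * real \<tau>" using m(1) by linarith
    have "real m + 1 \<le> real (9 ^ (k + 1))" using k(2) by linarith
    \<comment> \<open>\<open>135 = 9 * 15\<close>: \<open>M = a / 15\<close>, and rounding down to a
      power of 9 loses at most a factor 9.\<close>
    then have M_ge: "real_of_int M \<ge> \<eta> * real \<tau> / 135"
      using m(2) by (simp add: M_def)
    have "\<eta> * real \<tau> \<le> 1 / 4 * real \<tau>" using \<eta> by (intro mult_right_mono) auto
    then have a4: "4 * a \<le> \<tau>" using a_le by linarith
    have a8: "a \<ge> 10800" unfolding a_def by simp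
    obtain K where K: "(2::nat) ^ (a + \<tau>) \<le> 3 ^ K" "(3::nat) ^ K \<le> 3 * 2 ^ (a + \<tau>)"
      using ex_pow3_between[of "2 ^ (a + \<tau>)"] by auto
    note Kb = pow3_exponent_bounds[OF K]
    \<comment> \<open>This equalises the two means; by \<open>Kb\<close> the subtraction is not
      truncated.\<close>
    define e where "e = 2 * K - \<tau>"
    have e: "e + \<tau> = 2 * K" "a + 2 \<le> e" "e \<le> \<tau>"
      using Kb a8 a4 unfolding e_def by auto
    define c where "c = card {n. n < (2::nat) ^ (a + e + \<tau>) \<and> digit_diff n = 0}"
    define Q where "Q = (real_of_int M + 1) ^ 2"
    have cheb: "(2 ^ \<tau> - real c) * Q \<le> 2 ^ \<tau> * (6 * real \<tau> + 4 * real e + 7 * real a + 22)"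
      unfolding c_def Q_def using cov e a4 a8 K
      by (intro card_digit_diff_eq_ge) (auto simp: M_def simp flip: of_nat_add)
    \<comment> \<open>\<open>6 + 4 + 7 / 4 + 1 \<le> 13\<close>; keeping half of the
      \<open>t\<close> takes twice this, hence 26.\<close>
    have V: "6 * real \<tau> + 4 * real e + 7 * real a + 22 \<le> 13 * real \<tau>"
      using e(3) a4 T3 by linarith
    have "26 * real \<tau> \<le> (\<eta> * real \<tau> / 135) ^ 2"
    proof -
      have "26 * 135 ^ 2 \<le> real \<tau> * \<eta> ^ 2" using T1 \<eta> by (simp add: field_simps)
      then have "26 * 135 ^ 2 * real \<tau> \<le> real \<tau> * \<eta> ^ 2 * real \<tau>"
        by (rule mult_right_mono) simp
      then show ?thesis by (simp add: field_simps power2_eq_square)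
    qed
    also have "\<dots> \<le> Q"
      unfolding Q_def using M_ge \<eta>\<tau> by (intro power_mono) linarith+
    finally have Q: "26 * real \<tau> \<le> Q" .
    have "2 ^ \<tau> \<le> 2 * c"
    proof (rule ccontr)
      assume "\<not> 2 ^ \<tau> \<le> 2 * c"
      then have "2 * c < 2 ^ \<tau>" by simp
      then have "real (2 * c) < real (2 ^ \<tau>)" by (rule of_nat_less_iff[THEN iffD2])
      then have c: "2 ^ \<tau> - real c > 2 ^ \<tau> / 2" by simp
      have "(2::real) ^ \<tau> / 2 > 0" by simp
      then have c0: "2 ^ \<tau> - real c \<ge> 0" using c by linarith
      have "2 ^ \<tau> / 2 * (26 * real \<tau>) < (2 ^ \<tau> - real c) * (26 * real \<tau>)"
        using c T3 by (intro mult_strict_right_mono) auto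
      also have "\<dots> \<le> (2 ^ \<tau> - real c) * Q"
        by (rule mult_left_mono[OF Q c0])
      also have "\<dots> \<le> 2 ^ \<tau> * (13 * real \<tau>)"
        using cheb V by (meson mult_left_mono order_trans zero_le_power zero_le_numeral)
      finally show False by simp
    qed
    moreover have "c \<le> card {n. n < N \<and> digit_diff n = 0}"
    proof -
      define \<rho> :: real where "\<rho> = ln 2 / ln 3"
      have "real (3 ^ K) \<le> real (3 * 2 ^ (a + \<tau>))"
        using K(2) by (rule of_nat_mono)
      then have "ln (real (3 ^ K)) \<le> ln (real (3 * 2 ^ (a + \<tau>)))"
        by (subst ln_le_cancel_iff) simp_all
      then have "real K * ln 3 \<le> ln 3 + (real a + real \<tau>) * ln 2"
        by (simp add: ln_mult ln_realpow)
      then have "real K \<le> 1 + (real a + real \<tau>) * \<rho>"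
        by (simp add: \<rho>_def field_simps)
      moreover have "real a * \<rho> \<le> real a * 1"
        by (intro mult_left_mono) (simp_all add: \<rho>_def)
      ultimately have "real a + 2 * real K \<le> 2 + real \<tau> * (2 * \<rho>) + 3 * real a"
        by (simp add: algebra_simps)
      moreover have "2 * ln 2 / ln 3 = 2 * \<rho>"
        by (simp add: \<rho>_def)
      \<comment> \<open>Of the \<open>4 * \<eta>\<close> in \<open>\<kappa>\<close>, three parts pay
        for \<open>3 * a\<close> and one for the constant 2.\<close>
      ultimately have "real (a + e + \<tau>) \<le> \<kappa> * real \<tau>"
        using a_le \<eta>\<tau> e(1) unfolding \<kappa>_def
        by (simp add: algebra_simps flip: of_nat_add)
      then have "2 powr real (a + e + \<tau>) \<le> real N"
        using N by (meson order_trans powr_mono one_le_numeral)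
      then have "real (2 ^ (a + e + \<tau>)) \<le> real N"
        by (simp only: powr_realpow zero_less_numeral of_nat_power of_nat_numeral)
      then have "2 ^ (a + e + \<tau>) \<le> N" by (simp only: of_nat_le_iff)
      then show ?thesis unfolding c_def by (intro card_mono) auto
    qed
    ultimately show ?thesis by linarith
  qed
  then show ?thesis by blast
qed

theorem theorem1p1:
  shows "infinite {n::nat. digit_sum 2 n = digit_sum 3 n} \<and>
    (\<forall>\<delta>::real. \<delta> > 0 \<longrightarrow>
      (\<exists>c::real. c > 0 \<and>
        (\<forall>N::nat. N \<ge> 1 \<longrightarrow>
          real (card {n::nat. n < N \<and> digit_sum 2 n = digit_sum 3 n})
            \<ge> c * real N powr (ln 3 / ln 4 - \<delta>))))"
proof (intro conjI allI impI)
  have eq: "digit_sum 2 n = digit_sum 3 n \<longleftrightarrow> digit_diff n = 0" for n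
    by (simp add: digit_diff_def)
  show "infinite {n. digit_sum 2 n = digit_sum 3 n}"
  proof
    assume fin: "finite {n. digit_sum 2 n = digit_sum 3 n}"
    define s where "s = card {n. digit_sum 2 n = digit_sum 3 n}"
    obtain \<tau>0 where \<tau>0: "\<forall>\<tau>\<ge>\<tau>0. \<forall>N. 2 powr ((2 * ln 2 / ln 3 + 4 * (1 / 4)) * real \<tau>) \<le> real N \<longrightarrow>
        2 ^ \<tau> \<le> 2 * card {n. n < N \<and> digit_diff n = 0}"
      using card_digit_diff_0_ge[of "1 / 4"] by auto
    \<comment> \<open>Then \<open>2 * s \<le> \<tau> < 2 ^ \<tau>\<close>, which contradicts the
      count.\<close>
    define \<tau> where "\<tau> = \<tau>0 + 2 * s"
    obtain N :: nat where N: "2 powr ((2 * ln 2 / ln 3 + 4 * (1 / 4)) * real \<tau>) \<le> real N"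
      using real_arch_simple by blast
    have "2 ^ \<tau> \<le> 2 * card {n. n < N \<and> digit_diff n = 0}"
      using \<tau>0 N by (simp add: \<tau>_def)
    also have "card {n. n < N \<and> digit_diff n = 0} \<le> s"
      unfolding s_def using fin by (intro card_mono) (auto simp: eq)
    finally have "2 ^ \<tau> \<le> 2 * s" by simp
    moreover have "\<tau> < 2 ^ \<tau>" by (rule less_exp)
    ultimately show False using \<tau>_def by linarith
  qed
  fix \<delta> :: real assume \<delta>: "\<delta> > 0"
  define \<eta> where "\<eta> = min (1 / 4) (\<delta> / 4)"
  have \<eta>: "0 < \<eta>" "\<eta> \<le> 1 / 4" "4 * \<eta> \<le> \<delta>" using \<delta> by (auto simp: \<eta>_def)
  define \<theta> :: real where "\<theta> = ln 3 / ln 4"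
  define \<kappa> where "\<kappa> = 2 * ln 2 / ln 3 + 4 * \<eta>"
  have ln4: "ln (4::real) = 2 * ln 2"
    using ln_realpow[of 2 2] by simp
  have \<theta>: "0 < \<theta>" "\<theta> < 1" by (simp_all add: \<theta>_def)
  have \<theta>\<kappa>: "2 * ln 2 / ln 3 = 1 / \<theta>" by (simp add: \<theta>_def ln4)
  have \<kappa>0: "\<kappa> > 0" using \<eta> \<theta> by (simp add: \<kappa>_def \<theta>\<kappa> add_pos_pos)
  \<comment> \<open>Here \<open>\<kappa> = 1 / \<theta> + 4 * \<eta>\<close>; as
    \<open>\<theta> < 1\<close>, passing from \<open>\<theta>\<close> to \<open>1 / \<kappa>\<close>
    costs at most \<open>4 * \<eta> \<le> \<delta>\<close>.\<close>
  have "(\<theta> - 4 * \<eta>) * \<kappa> = 1 - 4 * \<eta> * (1 / \<theta> - \<theta>) - 16 * \<eta> ^ 2"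
    using \<theta> by (simp add: \<kappa>_def \<theta>\<kappa> field_simps power2_eq_square)
  also have "\<dots> \<le> 1"
  proof -
    have "1 / \<theta> \<ge> 1" using \<theta> by simp
    then have "4 * \<eta> * (1 / \<theta> - \<theta>) \<ge> 0" using \<theta> \<eta> by (intro mult_nonneg_nonneg) linarith+
    then show ?thesis using zero_le_power2[of \<eta>] by linarith
  qed
  finally have "\<theta> - 4 * \<eta> \<le> 1 / \<kappa>" using \<kappa>0 by (simp add: field_simps)
  then have expo: "\<theta> - \<delta> \<le> 1 / \<kappa>" using \<eta> by linarith
  obtain \<tau>0 where \<tau>0: "\<And>\<tau> N. \<tau> \<ge> \<tau>0 \<Longrightarrow> 2 powr (\<kappa> * real \<tau>) \<le> real N \<Longrightarrow>
      2 ^ \<tau> \<le> 2 * card {n. n < N \<and> digit_diff n = 0}"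
    using card_digit_diff_0_ge[OF \<eta>(1,2)] unfolding \<kappa>_def by blast
  define B where "B = 2 powr (\<kappa> * real \<tau>0)"
  have B: "B > 0" by (simp add: B_def)
  \<comment> \<open>\<open>1 / 4\<close> pays for keeping half of the \<open>t\<close> and for
    rounding \<open>\<tau>\<close> down; \<open>1 / B\<close> serves the bounded \<open>N\<close>,
    where the solution \<open>n = 0\<close> suffices.\<close>
  define c where "c = min (1 / 4) (1 / B)"
  have "c * real N powr (\<theta> - \<delta>) \<le> real (card {n. n < N \<and> digit_diff n = 0})"
    if N: "N \<ge> 1" for N
  proof -
    define \<tau> where "\<tau> = nat \<lfloor>log 2 (real N) / \<kappa>\<rfloor>"
    have log0: "log 2 (real N) / \<kappa> \<ge> 0" using N \<kappa>0 by simp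
    have \<tau>: "real \<tau> \<le> log 2 (real N) / \<kappa>" "log 2 (real N) / \<kappa> < real \<tau> + 1"
      using log0 unfolding \<tau>_def by linarith+
    have pow_log: "2 powr log 2 (real N) = real N" using N by simp
    show ?thesis
    proof (cases "\<tau> \<ge> \<tau>0")
      case True
      have "\<kappa> * real \<tau> \<le> log 2 (real N)" using \<tau>(1) \<kappa>0 by (simp add: field_simps)
      then have "2 powr (\<kappa> * real \<tau>) \<le> 2 powr log 2 (real N)" by (intro powr_mono) auto
      then have "2 powr (\<kappa> * real \<tau>) \<le> real N" unfolding pow_log .
      then have "2 ^ \<tau> \<le> 2 * card {n. n < N \<and> digit_diff n = 0}" by (rule \<tau>0[OF True])
      then have "real (2 ^ \<tau>) \<le> real (2 * card {n. n < N \<and> digit_diff n = 0})"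
        by (rule of_nat_mono)
      then have card: "2 ^ \<tau> \<le> 2 * real (card {n. n < N \<and> digit_diff n = 0})"
        by simp
      have "real N powr (\<theta> - \<delta>) \<le> real N powr (1 / \<kappa>)"
        using expo N by (intro powr_mono) auto
      also have "\<dots> = (2 powr log 2 (real N)) powr (1 / \<kappa>)" unfolding pow_log ..
      also have "\<dots> = 2 powr (log 2 (real N) / \<kappa>)" by (simp only: powr_powr) simp
      also have "\<dots> \<le> 2 powr (real \<tau> + 1)" using \<tau>(2) by (intro powr_mono) auto
      also have "\<dots> = 2 * 2 ^ \<tau>" by (simp add: powr_add powr_realpow)
      finally have "real N powr (\<theta> - \<delta>) \<le> 4 * real (card {n. n < N \<and> digit_diff n = 0})"
        using card by linarith
      moreover have "c * real N powr (\<theta> - \<delta>) \<le> 1 / 4 * real N powr (\<theta> - \<delta>)"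
        by (intro mult_right_mono) (simp_all add: c_def)
      ultimately show ?thesis by linarith
    next
      case False
      then have "log 2 (real N) / \<kappa> < real \<tau>0" using \<tau>(2) by linarith
      then have "log 2 (real N) < \<kappa> * real \<tau>0" using \<kappa>0 by (simp add: field_simps)
      then have "2 powr log 2 (real N) \<le> B" unfolding B_def by (intro powr_mono) auto
      then have NB: "real N \<le> B" unfolding pow_log .
      have "real N powr (\<theta> - \<delta>) \<le> real N powr 1"
        using N \<theta> \<delta> by (intro powr_mono) auto
      then have "real N powr (\<theta> - \<delta>) \<le> B" using NB by simp
      then have "c * real N powr (\<theta> - \<delta>) \<le> 1 / B * B"
        using B by (intro mult_mono) (auto simp: c_def)
      also have "\<dots> = real (card {0::nat})" using B by simp
      also have "\<dots> \<le> real (card {n. n < N \<and> digit_diff n = 0})"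
        using N by (intro of_nat_mono card_mono) (auto simp: digit_diff_def)
      finally show ?thesis .
    qed
  qed
  moreover have "c > 0" using B by (simp add: c_def)
  ultimately show "\<exists>c>0. \<forall>N\<ge>1. c * real N powr (ln 3 / ln 4 - \<delta>)
      \<le> real (card {n. n < N \<and> digit_sum 2 n = digit_sum 3 n})"
    unfolding eq \<theta>_def[symmetric] by blast
qed

end
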